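(* Let $p$ be a prime, $n,m\ge1$ integers, and let $F,G:\mathbb{F}_{p^n}\to\mathbb{F}_{p^m}$ be EA-equivalent, with $G=B\circ F\circ A+C$, where $A(x)=A_0(x)+a$ is an affine permutation of $\mathbb{F}_{p^n}$, $B(y)=B_0(y)+b$ is an affine permutation of $\mathbb{F}_{p^m}$, and $C(x)=C_0(x)+c$ is an affine map $\mathbb{F}_{p^n}\to\mathbb{F}_{p^m}$ (with $A_0,B_0$ invertible $\mathbb{F}_p$-linear and $C_0$ $\mathbb{F}_p$-linear). Let $B_0^*$ be the adjoint of $B_0$ for the trace pairing. Then, for every $u\in\mathbb{F}_{p^n}$, $v\in\mathbb{F}_{p^m}$ and $j\in\mathbb{F}_p$, $$L_G(u,v;j)=L_F\!\left(A_0(u),B_0^*(v);\,j-\mathrm{Tr}_1^m(vC_0(u))\right).$$ Equivalently, the autocorrelations satisfy, for every $u\in\mathbb{F}_{p^n}$ and $v\in\mathbb{F}_{p^m}$, $$\mathrm{AC}_G(u,v)=\zeta_p^{\mathrm{Tr}_1^m(vC_0(u))}\,\mathrm{AC}_F\bigl(A_0(u),B_0^*(v)\bigr).$$ In particular, if $F$ and $G$ are affine equivalent, so that $C=0$, then $$L_G(u,v;j)=L_F\bigl(A_0(u),B_0^*(v);j\bigr).$$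
   Context: $\zeta_p=e^{2\pi i/p}$; $\mathrm{Tr}_1^m$ is the absolute trace $\mathbb{F}_{p^m}\to\mathbb{F}_p$. Affine and linear are over $\mathbb{F}_p$. Two functions $F,G:\mathbb{F}_{p^n}\to\mathbb{F}_{p^m}$ are EA-equivalent if $G=B\circ F\circ A+C$ for some affine permutations $A$ of $\mathbb{F}_{p^n}$ and $B$ of $\mathbb{F}_{p^m}$ and some affine map $C:\mathbb{F}_{p^n}\to\mathbb{F}_{p^m}$; they are affine equivalent when one may take $C=0$. The adjoint $B_0^*$ is the $\mathbb{F}_p$-linear map on $\mathbb{F}_{p^m}$ characterized by $\mathrm{Tr}_1^m(vB_0(y))=\mathrm{Tr}_1^m(B_0^*(v)y)$ for all $v,y\in\mathbb{F}_{p^m}$. The derivative is $D_uF(x)=F(x+u)-F(x)$. The additive autocorrelation is $\mathrm{AC}_F(u,v)=\sum_{x\in\mathbb{F}_{p^n}}\zeta_p^{\mathrm{Tr}_1^m(vD_uF(x))}$, and the centered level count is $L_F(u,v;j)=\#\{x\in\mathbb{F}_{p^n}:\mathrm{Tr}_1^m(vD_uF(x))=j\}-p^{n-1}$. *)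

theory Defs
  imports Complex_Main "Berlekamp_Zassenhaus.Finite_Field"
begin

text \<open>
  The prime field is the type \<open>'p mod_ring\<close> of integers modulo \<open>p = CARD('p)\<close>, where
  \<open>'p :: prime_card\<close>. The field with \<open>p\<close> to the power \<open>n\<close> elements is an arbitrary type
  \<open>'a :: finite_field\<close> with \<open>CARD('a) = CARD('p) ^ n\<close>. As function types between such fields
  do not mention \<open>'p\<close>, notions relative to the prime field take \<open>TYPE('p)\<close> as an argument
  where necessary.
\<close>

definition Fp_embed :: "'p::prime_card mod_ring \<Rightarrow> 'a::finite_field" where
  "Fp_embed c = of_int (to_int_mod_ring c)"

definition Fp_scale :: "'p::prime_card mod_ring \<Rightarrow> 'a::finite_field \<Rightarrow> 'a" where
  "Fp_scale c x = Fp_embed c * x"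

definition Fp_linear ::
    "'p::prime_card itself \<Rightarrow> ('a::finite_field \<Rightarrow> 'b::finite_field) \<Rightarrow> bool" where
  "Fp_linear _ f \<longleftrightarrow>
     Vector_Spaces.linear (Fp_scale :: 'p mod_ring \<Rightarrow> 'a \<Rightarrow> 'a) (Fp_scale :: 'p mod_ring \<Rightarrow> 'b \<Rightarrow> 'b) f"

definition Fp_affine ::
    "'p::prime_card itself \<Rightarrow> ('a::finite_field \<Rightarrow> 'b::finite_field) \<Rightarrow> bool" where
  "Fp_affine P f \<longleftrightarrow> (\<exists>f0 c. Fp_linear P f0 \<and> f = (\<lambda>x. f0 x + c))"

definition EA_equivalent_via ::
    "'p::prime_card itself \<Rightarrow> ('a::finite_field \<Rightarrow> 'a) \<Rightarrow> ('b::finite_field \<Rightarrow> 'b) \<Rightarrow> ('a \<Rightarrow> 'b) \<Rightarrow>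
     ('a \<Rightarrow> 'b) \<Rightarrow> ('a \<Rightarrow> 'b) \<Rightarrow> bool" where
  "EA_equivalent_via P A B C F G \<longleftrightarrow>
     Fp_affine P A \<and> bij A \<and> Fp_affine P B \<and> bij B \<and> Fp_affine P C \<and>
     G = (\<lambda>x. (B \<circ> F \<circ> A) x + C x)"

text \<open>
  The power sum in the definition of the trace lies in the image of \<open>Fp_embed\<close>; see
  \<open>Fp_embed_abs_trace\<close> below. The parameter \<open>m\<close> is the degree of the field over its prime field.
\<close>

definition abs_trace :: "nat \<Rightarrow> 'b::finite_field \<Rightarrow> 'p::prime_card mod_ring" where
  "abs_trace m y = (THE c. Fp_embed c = (\<Sum>i<m. y ^ (CARD('p) ^ i)))"

text \<open>
  For \<open>CARD('b) = CARD('p) ^ m\<close> and linear \<open>B0\<close> the adjoint exists and is unique, since the trace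
  form is nondegenerate.
\<close>

definition trace_adjoint ::
    "'p::prime_card itself \<Rightarrow> nat \<Rightarrow> ('b::finite_field \<Rightarrow> 'b) \<Rightarrow> ('b \<Rightarrow> 'b)" where
  "trace_adjoint P m B0 = (THE S. Fp_linear P S \<and>
     (\<forall>v y. (abs_trace m (v * B0 y) :: 'p mod_ring) = abs_trace m (S v * y)))"

definition diff_deriv :: "('a::finite_field \<Rightarrow> 'b::finite_field) \<Rightarrow> 'a \<Rightarrow> 'a \<Rightarrow> 'b" where
  "diff_deriv F u x = F (x + u) - F x"

definition zeta_pow :: "'p::prime_card mod_ring \<Rightarrow> complex" where
  "zeta_pow t = exp (2 * of_real pi * \<i> / of_nat CARD('p)) ^ nat (to_int_mod_ring t)"

definition autocorr ::
    "'p::prime_card itself \<Rightarrow> nat \<Rightarrow> ('a::finite_field \<Rightarrow> 'b::finite_field) \<Rightarrow> 'a \<Rightarrow> 'b \<Rightarrow> complex" where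
  "autocorr _ m F u v = (\<Sum>x\<in>UNIV. zeta_pow (abs_trace m (v * diff_deriv F u x) :: 'p mod_ring))"

text \<open>Here \<open>n\<close> and \<open>m\<close> are the degrees of the domain and the codomain of \<open>F\<close>.\<close>

definition level_count ::
    "nat \<Rightarrow> nat \<Rightarrow> ('a::finite_field \<Rightarrow> 'b::finite_field) \<Rightarrow> 'a \<Rightarrow> 'b \<Rightarrow> 'p::prime_card mod_ring \<Rightarrow> int" where
  "level_count n m F u v j =
     int (card {x. abs_trace m (v * diff_deriv F u x) = j}) - int (CARD('p) ^ (n - 1))"

lemma CHAR_of_card_power:
  assumes "CARD('a::finite_field) = CARD('p::prime_card) ^ n"
  shows "CHAR('a) = CARD('p)"
proof -
  have "CHAR('a) dvd CARD('p) ^ n"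
    using CHAR_dvd_CARD[where 'a='a] assms by simp
  then have "CHAR('a) dvd CARD('p)"
    using CHAR_prime[where 'a='a] prime_dvd_power by blast
  then show ?thesis
    using CHAR_prime[where 'a='a] prime_card[where 'a='p] primes_dvd_imp_eq by blast
qed

lemma Fp_embed_of_int:
  assumes "CHAR('a::finite_field) = CARD('p::prime_card)"
  shows "(Fp_embed (of_int k :: 'p mod_ring) :: 'a) = of_int k"
proof -
  have "to_int_mod_ring (of_int k :: 'p mod_ring) = k mod int CARD('p)"
    unfolding of_int_of_int_mod_ring by transfer simp
  then show ?thesis
    unfolding Fp_embed_def using assms by (metis of_int_mod_CHAR)
qed

lemma Fp_embed_hom:
  assumes "CHAR('a::finite_field) = CARD('p::prime_card)"
  shows "(Fp_embed (c + d :: 'p mod_ring) :: 'a) = Fp_embed c + Fp_embed d"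
    and "(Fp_embed (c * d :: 'p mod_ring) :: 'a) = Fp_embed c * Fp_embed d"
    and "(Fp_embed (1 :: 'p mod_ring) :: 'a) = 1"
  unfolding Fp_embed_def to_int_mod_ring_add to_int_mod_ring_mult assms[symmetric]
  by (simp_all add: to_int_mod_ring_hom.hom_one)

lemma vector_space_Fp_scale:
  assumes "CHAR('a::finite_field) = CARD('p::prime_card)"
  shows "vector_space (Fp_scale :: 'p mod_ring \<Rightarrow> 'a \<Rightarrow> 'a)"
  by unfold_locales (simp_all add: Fp_scale_def Fp_embed_hom[OF assms] algebra_simps)

lemma inj_Fp_embed:
  assumes "CHAR('a::finite_field) = CARD('p::prime_card)"
  shows "inj (Fp_embed :: 'p mod_ring \<Rightarrow> 'a)"
proof (rule injI)
  fix c d :: "'p mod_ring"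
  assume "(Fp_embed c :: 'a) = Fp_embed d"
  then have "[to_int_mod_ring c = to_int_mod_ring d] (mod int CARD('p))"
    unfolding Fp_embed_def using assms by (simp add: of_int_eq_iff_cong_CHAR)
  moreover have "to_int_mod_ring c \<in> {0..<int CARD('p)}" "to_int_mod_ring d \<in> {0..<int CARD('p)}"
    using range_to_int_mod_ring[where 'a='p] by blast+
  ultimately have "to_int_mod_ring c = to_int_mod_ring d"
    by (simp add: cong_def)
  then show "c = d"
    by (metis of_int_mod_ring_to_int_mod_ring)
qed

lemma range_Fp_embed:
  assumes "CHAR('a::finite_field) = CARD('p::prime_card)"
  shows "range (Fp_embed :: 'p mod_ring \<Rightarrow> 'a) = {x. x ^ CARD('p) = x}"
proof (rule card_subset_eq)
  show "finite {x::'a. x ^ CARD('p) = x}" by simp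
  have p: "CARD('p) > 1" by (rule nontriv)
  show sub: "range (Fp_embed :: 'p mod_ring \<Rightarrow> 'a) \<subseteq> {x. x ^ CARD('p) = x}"
  proof clarify
    fix c :: "'p mod_ring"
    have "c ^ CARD('p) = c"
      using finite_field_power_card_eq_same[of c] by simp
    moreover have "(Fp_embed (c ^ k) :: 'a) = Fp_embed c ^ k" for k
      by (induction k) (simp_all add: Fp_embed_hom[OF assms])
    ultimately show "(Fp_embed c :: 'a) ^ CARD('p) = Fp_embed c" by metis
  qed
  define q :: "'a poly" where "q = monom 1 CARD('p) - monom 1 1"
  have "coeff q CARD('p) = 1" unfolding q_def using p by simp
  then have "q \<noteq> 0" by auto
  have "degree q \<le> CARD('p)"
    unfolding q_def using p by (intro degree_diff_le) (simp_all add: degree_monom_eq)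
  have "{x::'a. x ^ CARD('p) = x} = {x. poly q x = 0}"
    unfolding q_def by (simp add: poly_monom)
  then have "card {x::'a. x ^ CARD('p) = x} \<le> CARD('p)"
    using poly_roots_degree[OF \<open>q \<noteq> 0\<close>] \<open>degree q \<le> CARD('p)\<close> by simp
  moreover have "card (range (Fp_embed :: 'p mod_ring \<Rightarrow> 'a)) = CARD('p)"
    using card_image[OF inj_Fp_embed[OF assms]] by simp
  moreover have "card (range (Fp_embed :: 'p mod_ring \<Rightarrow> 'a)) \<le> card {x::'a. x ^ CARD('p) = x}"
    using sub by (intro card_mono) simp_all
  ultimately show "card (range (Fp_embed :: 'p mod_ring \<Rightarrow> 'a)) = card {x::'a. x ^ CARD('p) = x}"
    by simp
qed

lemma Fp_embed_abs_trace:
  fixes y :: "'b::finite_field"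
  assumes card: "CARD('b) = CARD('p::prime_card) ^ m"
  shows "Fp_embed (abs_trace m y :: 'p mod_ring) = (\<Sum>i<m. y ^ (CARD('p) ^ i))"
proof -
  define p where "p = CARD('p)"
  note char = CHAR_of_card_power[OF card]
  let ?s = "\<Sum>i<m. y ^ (p ^ i)"
  have "?s ^ p = (\<Sum>i<m. (y ^ (p ^ i)) ^ p)"
    using freshmans_dream_sum[where 'a='b] char p_def by (metis CHAR_prime)
  also have "\<dots> = (\<Sum>i<m. y ^ (p ^ Suc i))"
    by (intro sum.cong refl) (simp add: power_mult [symmetric] mult.commute)
  also have "\<dots> = ?s"
  proof -
    have "y ^ (p ^ m) = y"
      using finite_field_power_card_eq_same[of y] card p_def by simp
    then show ?thesis
      using sum.lessThan_Suc_shift[of "\<lambda>i. y ^ (p ^ i)" m] sum.lessThan_Suc[of "\<lambda>i. y ^ (p ^ i)" m]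
      by (simp add: add.commute)
  qed
  finally have "?s \<in> range (Fp_embed :: 'p mod_ring \<Rightarrow> 'b)"
    unfolding range_Fp_embed[OF char] p_def by simp
  then obtain c :: "'p mod_ring" where "Fp_embed c = ?s" by (metis rangeE)
  then have "\<exists>!c :: 'p mod_ring. Fp_embed c = ?s"
    using inj_Fp_embed[OF char] by (metis injD)
  then show ?thesis
    unfolding abs_trace_def p_def by (rule theI')
qed

end

theory Submission
  imports Defs
begin

text \<open>
  The derivative satisfies \<open>D\<^sub>u G (x) = B0 (D\<^sub>w F (A x)) + C0 u\<close> with \<open>w = A0 u\<close>, because the constants
  \<open>b\<close> and \<open>c\<close> cancel. Moving \<open>B0\<close> to the other side of the trace pairing and substituting
  \<open>A x\<close> for \<open>x\<close> gives the claims. The adjoint exists because every additive functional \<open>\<phi>\<close> is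
  \<open>y \<mapsto> Tr (s y)\<close> for some \<open>s\<close>: otherwise the double sum of \<open>\<zeta>\<close> to the power \<open>\<phi> y - Tr (s y)\<close>
  over \<open>s\<close> and \<open>y\<close> would vanish when summed over \<open>y\<close> first, while summing over \<open>s\<close> first leaves
  only the term \<open>y = 0\<close>, which is the order of the field.
\<close>

section \<open>The additive character \<open>zeta_pow\<close> of the prime field\<close>

lemma zeta_pow_eq_cis:
  "zeta_pow (t :: 'p::prime_card mod_ring) =
     cis (2 * pi * real (nat (to_int_mod_ring t)) / real CARD('p))"
proof -
  have "exp (2 * of_real pi * \<i> / of_nat CARD('p)) = cis (2 * pi / real CARD('p))"
    by (simp add: cis_conv_exp mult_ac)
  then show ?thesis
    by (simp add: zeta_pow_def DeMoivre mult_ac)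
qed

lemma to_int_mod_ring_bounds:
  fixes t :: "'p::prime_card mod_ring"
  shows "0 \<le> to_int_mod_ring t" "to_int_mod_ring t < int CARD('p)"
  using range_to_int_mod_ring[where 'a='p] by (auto dest: equalityD1)

lemma zeta_pow_0 [simp]: "zeta_pow (0 :: 'p::prime_card mod_ring) = 1"
  by (simp add: zeta_pow_def)

text \<open>Integer representatives add only modulo \<open>CARD('p)\<close>, which is harmless
  because the base is a root of unity of that order.\<close>

lemma zeta_pow_add: "zeta_pow (s + t :: 'p::prime_card mod_ring) = zeta_pow s * zeta_pow t"
proof -
  define w where "w = exp (2 * of_real pi * \<i> / of_nat CARD('p))"
  have "w ^ CARD('p) = 1"
    unfolding w_def by (simp flip: exp_of_nat_mult)
  then have w: "w ^ (k mod CARD('p)) = w ^ k" for k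
    by (metis div_mult_mod_eq mult.commute mult_1 power_add power_mult power_one)
  have "nat (to_int_mod_ring (s + t)) =
      (nat (to_int_mod_ring s) + nat (to_int_mod_ring t)) mod CARD('p)"
    by (simp add: to_int_mod_ring_add nat_mod_distrib nat_add_distrib to_int_mod_ring_bounds)
  then show ?thesis
    by (simp only: zeta_pow_def w_def[symmetric] w power_add)
qed

text \<open>Exponents below \<open>CARD('p)\<close> index distinct roots of unity, and
  \<open>1\<close> is the one with index \<open>0\<close>.\<close>

lemma zeta_pow_eq_1_iff:
  fixes t :: "'p::prime_card mod_ring"
  shows "zeta_pow t = 1 \<longleftrightarrow> t = 0"
proof
  assume "zeta_pow t = 1"
  then have "cis (2 * pi * real (nat (to_int_mod_ring t)) / real CARD('p)) =
      cis (2 * pi * real 0 / real CARD('p))"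
    by (simp add: zeta_pow_eq_cis)
  moreover have "nat (to_int_mod_ring t) < CARD('p)"
    using to_int_mod_ring_bounds[of t] by linarith
  ultimately have "nat (to_int_mod_ring t) = 0"
    using inj_onD[OF bij_betw_imp_inj_on[OF bij_betw_roots_unity[OF zero_less_card_finite]],
        where x = "nat (to_int_mod_ring t)" and y = 0]
    by simp
  then have "to_int_mod_ring t = 0"
    using to_int_mod_ring_bounds[of t] by linarith
  then show "t = 0"
    by simp
qed simp

text \<open>Translating the summation variable by \<open>z\<close> multiplies the sum by
  \<open>zeta_pow (\<psi> z)\<close>, a factor different from \<open>1\<close>.\<close>

lemma sum_zeta_pow_eq_0:
  fixes \<psi> :: "'b::finite_field \<Rightarrow> 'p::prime_card mod_ring"
  assumes add: "\<And>x y. \<psi> (x + y) = \<psi> x + \<psi> y" and nz: "\<psi> z \<noteq> 0"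
  shows "(\<Sum>y\<in>UNIV. zeta_pow (\<psi> y)) = 0"
proof -
  have "(\<Sum>y\<in>UNIV. zeta_pow (\<psi> y)) = (\<Sum>y\<in>UNIV. zeta_pow (\<psi> (z + y)))"
    by (rule sum.reindex_bij_betw[symmetric]) (rule bij_plus)
  also have "\<dots> = zeta_pow (\<psi> z) * (\<Sum>y\<in>UNIV. zeta_pow (\<psi> y))"
    by (simp add: add zeta_pow_add sum_distrib_left)
  finally show ?thesis
    using nz zeta_pow_eq_1_iff[of "\<psi> z"] by auto
qed

section \<open>Additivity and nondegeneracy of the trace form\<close>

lemma abs_trace_add:
  fixes x y :: "'b::finite_field"
  assumes card: "CARD('b) = CARD('p::prime_card) ^ m"
  shows "(abs_trace m (x + y) :: 'p mod_ring) = abs_trace m x + abs_trace m y"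
proof -
  note char = CHAR_of_card_power[OF card]
  have "(x + y) ^ CARD('p) ^ i = x ^ CARD('p) ^ i + y ^ CARD('p) ^ i" for i
    using freshmans_dream'[where 'a='b, OF CHAR_prime refl] char by metis
  \<comment> \<open>The comparison takes place in the large field, where the trace is a sum of
    Frobenius powers; injectivity of \<open>Fp_embed\<close> brings it back.\<close>
  then have "(Fp_embed (abs_trace m (x + y) :: 'p mod_ring) :: 'b) =
      Fp_embed (abs_trace m x + abs_trace m y :: 'p mod_ring)"
    by (simp add: Fp_embed_abs_trace[OF card] Fp_embed_hom[OF char] sum.distrib)
  then show ?thesis
    using inj_Fp_embed[OF char] by (blast dest: injD)
qed

lemma abs_trace_0:
  assumes card: "CARD('b::finite_field) = CARD('p::prime_card) ^ m"
  shows "(abs_trace m (0 :: 'b) :: 'p mod_ring) = 0"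
  using abs_trace_add[OF card, of 0 0] by (metis add_cancel_right_right add_0)

lemma abs_trace_diff:
  fixes x y :: "'b::finite_field"
  assumes card: "CARD('b) = CARD('p::prime_card) ^ m"
  shows "(abs_trace m (x - y) :: 'p mod_ring) = abs_trace m x - abs_trace m y"
  using abs_trace_add[OF card, of "x - y" y] by (simp add: algebra_simps)

text \<open>The trace is a polynomial of degree less than the order of the field.\<close>

lemma abs_trace_neq_0:
  assumes card: "CARD('b::finite_field) = CARD('p::prime_card) ^ m" and "m \<ge> 1"
  shows "\<exists>y::'b. (abs_trace m y :: 'p mod_ring) \<noteq> 0"
proof (rule ccontr)
  assume "\<not> ?thesis"
  then have tr: "(abs_trace m y :: 'p mod_ring) = 0" for y :: 'b by blast
  note char = CHAR_of_card_power[OF card]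
  have p: "CARD('p) > 1" by (rule nontriv)
  define q :: "'b poly" where "q = (\<Sum>i<m. monom 1 (CARD('p) ^ i))"
  have poly_q: "poly q y = 0" for y
  proof -
    have "poly q y = Fp_embed (abs_trace m y :: 'p mod_ring)"
      by (simp add: q_def poly_sum poly_monom Fp_embed_abs_trace[OF card])
    then show ?thesis
      by (simp add: tr Fp_embed_def)
  qed
  \<comment> \<open>Only \<open>i = 0\<close> contributes to the linear coefficient, and
    \<open>m \<ge> 1\<close> ensures that this term occurs.\<close>
  have "coeff q 1 = (\<Sum>i<m. if i = 0 then 1 else 0)"
    unfolding q_def coeff_sum using p by (intro sum.cong) (auto simp: power_eq_1_iff)
  also have "\<dots> = 1"
    using \<open>m \<ge> 1\<close> by simp
  finally have "q \<noteq> 0" by auto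
  have "degree q \<le> CARD('p) ^ (m - 1)"
    unfolding q_def
  proof (rule degree_sum_le)
    fix i assume "i \<in> {..<m}"
    then have "CARD('p) ^ i \<le> CARD('p) ^ (m - 1)"
      using p by (intro power_increasing) auto
    then show "degree (monom (1::'b) (CARD('p) ^ i)) \<le> CARD('p) ^ (m - 1)"
      by (simp add: degree_monom_eq)
  qed simp
  also have "\<dots> < CARD('p) ^ m"
    using p \<open>m \<ge> 1\<close> by (intro power_strict_increasing) auto
  also have "\<dots> = card {y. poly q y = 0}"
    by (simp add: poly_q card)
  also have "\<dots> \<le> degree q"
    by (rule poly_roots_degree) fact
  finally show False by simp
qed

lemma abs_trace_nondegenerate:
  fixes s :: "'b::finite_field"
  assumes card: "CARD('b) = CARD('p::prime_card) ^ m" and "m \<ge> 1" and "s \<noteq> 0"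
  shows "\<exists>y. (abs_trace m (s * y) :: 'p mod_ring) \<noteq> 0"
proof -
  obtain y :: 'b where "(abs_trace m y :: 'p mod_ring) \<noteq> 0"
    using abs_trace_neq_0[OF card \<open>m \<ge> 1\<close>] by blast
  then have "(abs_trace m (s * (y / s)) :: 'p mod_ring) \<noteq> 0"
    using \<open>s \<noteq> 0\<close> by simp
  then show ?thesis ..
qed

text \<open>Nondegeneracy as a cancellation rule: it yields both the linearity and the uniqueness of
  the adjoint.\<close>

lemma abs_trace_eqD:
  fixes s t :: "'b::finite_field"
  assumes card: "CARD('b) = CARD('p::prime_card) ^ m" and "m \<ge> 1"
    and eq: "\<And>y. (abs_trace m (s * y) :: 'p mod_ring) = abs_trace m (t * y)"
  shows "s = t"
proof (rule ccontr)
  assume "s \<noteq> t"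
  then obtain y where "(abs_trace m ((s - t) * y) :: 'p mod_ring) \<noteq> 0"
    using abs_trace_nondegenerate[OF card \<open>m \<ge> 1\<close>, of "s - t"] by auto
  then show False
    by (simp add: left_diff_distrib abs_trace_diff[OF card] eq)
qed

lemma abs_trace_represents:
  fixes \<phi> :: "'b::finite_field \<Rightarrow> 'p::prime_card mod_ring"
  assumes card: "CARD('b) = CARD('p) ^ m" and "m \<ge> 1"
    and add: "\<And>x y. \<phi> (x + y) = \<phi> x + \<phi> y"
  shows "\<exists>s. \<forall>y. \<phi> y = abs_trace m (s * y)"
proof (rule ccontr)
  assume "\<not> ?thesis"
  then have ex: "\<exists>y. \<phi> y - abs_trace m (s * y) \<noteq> 0" for s by simp
  have inner: "(\<Sum>y\<in>UNIV. zeta_pow (\<phi> y - abs_trace m (s * y))) = 0" for s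
  proof -
    obtain z where "\<phi> z - abs_trace m (s * z) \<noteq> 0" using ex by blast
    then show ?thesis
      by (intro sum_zeta_pow_eq_0[where z = z])
        (simp_all add: add abs_trace_add[OF card] distrib_left)
  qed
  have outer: "(\<Sum>s\<in>UNIV. zeta_pow (\<phi> y - abs_trace m (s * y))) =
      (if y = 0 then of_nat CARD('b) else 0)" for y
  proof (cases "y = 0")
    case True
    moreover have "\<phi> 0 = 0"
      using add[of 0 0] by (metis add_cancel_right_right add_0)
    ultimately show ?thesis
      by (simp add: abs_trace_0[OF card])
  next
    case False
    then obtain z where "(abs_trace m (- y * z) :: 'p mod_ring) \<noteq> 0"
      using abs_trace_nondegenerate[OF card \<open>m \<ge> 1\<close>, of "- y"] by auto
    then have "(\<Sum>s\<in>UNIV. zeta_pow (abs_trace m (- y * s) :: 'p mod_ring)) = 0"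
      by (intro sum_zeta_pow_eq_0[where z = z]) (simp only: distrib_left abs_trace_add[OF card])
    \<comment> \<open>For fixed \<open>y\<close> the factor with \<open>\<phi> y\<close> is constant
      in \<open>s\<close>; the minus sign goes into \<open>- y\<close>, so that the other exponent
      is additive in \<open>s\<close>.\<close>
    moreover have "zeta_pow (\<phi> y - abs_trace m (s * y)) =
        zeta_pow (\<phi> y) * zeta_pow (abs_trace m (- y * s) :: 'p mod_ring)" for s
      using abs_trace_diff[OF card, of 0 "s * y"]
      by (simp add: abs_trace_0[OF card] mult.commute flip: zeta_pow_add)
    ultimately show ?thesis
      using False by (simp only: sum_distrib_left[symmetric] if_False mult_zero_right)
  qed
  have "0 = (\<Sum>s\<in>UNIV. \<Sum>y\<in>UNIV. zeta_pow (\<phi> y - abs_trace m (s * y)))"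
    by (simp add: inner)
  also have "\<dots> = (\<Sum>y\<in>UNIV. \<Sum>s\<in>UNIV. zeta_pow (\<phi> y - abs_trace m (s * y)))"
    by (rule sum.swap)
  also have "\<dots> = of_nat CARD('b)"
    by (simp add: outer)
  finally show False by simp
qed

section \<open>Linear maps and their trace adjoints\<close>

lemma Fp_linear_iff:
  fixes f :: "'a::finite_field \<Rightarrow> 'b::finite_field"
  assumes "CHAR('a) = CARD('p::prime_card)" and "CHAR('b) = CARD('p)"
  shows "Fp_linear TYPE('p) f \<longleftrightarrow>
    (\<forall>x y. f (x + y) = f x + f y) \<and>
    (\<forall>(c :: 'p mod_ring) x. f (Fp_embed c * x) = Fp_embed c * f x)"
  using vector_space_Fp_scale[OF assms(1)] vector_space_Fp_scale[OF assms(2)]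
  by (simp add: Fp_linear_def Vector_Spaces.linear_iff Fp_scale_def)

text \<open>The definite description in \<open>trace_adjoint\<close> requires existence and
  uniqueness. For each \<open>v\<close> the functional sending \<open>y\<close> to the trace of
  \<open>v * B0 y\<close> is represented by some \<open>S v\<close>, and nondegeneracy makes
  \<open>S\<close> linear and unique.\<close>

lemma abs_trace_adjoint:
  fixes B0 :: "'b::finite_field \<Rightarrow> 'b"
  assumes card: "CARD('b) = CARD('p::prime_card) ^ m" and "m \<ge> 1"
    and lin: "Fp_linear TYPE('p) B0"
  shows "(abs_trace m (v * B0 y) :: 'p mod_ring) = abs_trace m (trace_adjoint TYPE('p) m B0 v * y)"
proof -
  note char = CHAR_of_card_power[OF card]
  note B0 = lin[unfolded Fp_linear_iff[OF char char]]
  let ?P = "\<lambda>S. Fp_linear TYPE('p) S \<and>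
    (\<forall>v y. (abs_trace m (v * B0 y) :: 'p mod_ring) = abs_trace m (S v * y))"
  have "\<exists>s. \<forall>y. (abs_trace m (v * B0 y) :: 'p mod_ring) = abs_trace m (s * y)" for v
    using B0 by (intro abs_trace_represents card \<open>m \<ge> 1\<close>) (simp add: distrib_left abs_trace_add[OF card])
  then obtain S where S: "\<And>v y. (abs_trace m (v * B0 y) :: 'p mod_ring) = abs_trace m (S v * y)"
    by metis
  have "S (v + w) = S v + S w" for v w
    by (rule abs_trace_eqD[OF card \<open>m \<ge> 1\<close>])
      (simp add: distrib_right abs_trace_add[OF card] flip: S)
  moreover have "S (Fp_embed c * v) = Fp_embed c * S v" for c :: "'p mod_ring" and v
  proof (rule abs_trace_eqD[OF card \<open>m \<ge> 1\<close>])
    fix y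
    \<comment> \<open>The scalar passes from \<open>v\<close> to the argument of \<open>B0\<close>
      by homogeneity, where \<open>S v\<close> can absorb it.\<close>
    have "(abs_trace m (S (Fp_embed c * v) * y) :: 'p mod_ring) =
        abs_trace m (v * B0 (Fp_embed c * y))"
      unfolding S[symmetric] using B0 by (simp add: mult_ac)
    then show "(abs_trace m (S (Fp_embed c * v) * y) :: 'p mod_ring) =
        abs_trace m (Fp_embed c * S v * y)"
      by (simp add: S mult_ac)
  qed
  ultimately have "?P S"
    using S by (simp add: Fp_linear_iff[OF char char])
  moreover have "T = S" if "?P T" for T
  proof
    show "T v = S v" for v
      using that S by (intro abs_trace_eqD[OF card \<open>m \<ge> 1\<close>]) metis
  qed
  ultimately have "?P (trace_adjoint TYPE('p) m B0)"
    unfolding trace_adjoint_def by (rule theI)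
  then show ?thesis by blast
qed

theorem theorem5p1:
  fixes F G :: "'a::finite_field \<Rightarrow> 'b::finite_field"
    and A A0 :: "'a \<Rightarrow> 'a" and a :: 'a
    and B B0 :: "'b \<Rightarrow> 'b" and b :: 'b
    and C C0 :: "'a \<Rightarrow> 'b" and c :: 'b
    and n m :: nat
  assumes "n \<ge> 1" and "m \<ge> 1"
    and "CARD('a) = CARD('p::prime_card) ^ n" and "CARD('b) = CARD('p) ^ m"
    and "EA_equivalent_via TYPE('p) A B C F G"
    and "A = (\<lambda>x. A0 x + a)" and "Fp_linear TYPE('p) A0" and "bij A0"
    and "B = (\<lambda>y. B0 y + b)" and "Fp_linear TYPE('p) B0" and "bij B0"
    and "C = (\<lambda>x. C0 x + c)" and "Fp_linear TYPE('p) C0"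
  shows "(\<forall>u v (j :: 'p mod_ring).
            level_count n m G u v j =
            level_count n m F (A0 u) (trace_adjoint TYPE('p) m B0 v) (j - abs_trace m (v * C0 u))) \<and>
         (\<forall>u v.
            autocorr TYPE('p) m G u v =
            zeta_pow (abs_trace m (v * C0 u) :: 'p mod_ring) *
            autocorr TYPE('p) m F (A0 u) (trace_adjoint TYPE('p) m B0 v)) \<and>
         (C = (\<lambda>x. 0) \<longrightarrow>
            (\<forall>u v (j :: 'p mod_ring).
               level_count n m G u v j =
               level_count n m F (A0 u) (trace_adjoint TYPE('p) m B0 v) j))"
proof -
  note card_a = assms(3) and card_b = assms(4)
  note char_a = CHAR_of_card_power[OF card_a] and char_b = CHAR_of_card_power[OF card_b]
  note A0 = assms(7)[unfolded Fp_linear_iff[OF char_a char_a]]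
    and B0 = assms(10)[unfolded Fp_linear_iff[OF char_b char_b]]
    and C0 = assms(13)[unfolded Fp_linear_iff[OF char_a char_b]]
  let ?S = "trace_adjoint TYPE('p) m B0"
  have "bij A" and G: "G x = B0 (F (A x)) + b + (C0 x + c)" for x
    using assms(5) by (simp_all add: EA_equivalent_via_def assms(9,12))
  have B0_diff: "B0 (x - y) = B0 x - B0 y" for x y
    using B0 by (metis add_diff_cancel diff_add_cancel)
  have deriv: "diff_deriv G u x = B0 (diff_deriv F (A0 u) (A x)) + C0 u" for u x
  proof -
    have "A (x + u) = A x + A0 u"
      using A0 by (simp add: assms(6))
    then show ?thesis
      using C0 by (simp add: diff_deriv_def G B0_diff)
  qed
  \<comment> \<open>Both main claims rest on this identity: the last summand does not depend on
    \<open>x\<close>, so it shifts the level and factors out of the character sum.\<close>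
  have trace: "(abs_trace m (v * diff_deriv G u x) :: 'p mod_ring) =
      abs_trace m (?S v * diff_deriv F (A0 u) (A x)) + abs_trace m (v * C0 u)" for u v x
    by (simp add: deriv distrib_left abs_trace_add[OF card_b]
        abs_trace_adjoint[OF card_b assms(2,10)])
  have level: "level_count n m G u v j =
      level_count n m F (A0 u) (?S v) (j - abs_trace m (v * C0 u))" for u v and j :: "'p mod_ring"
  proof -
    let ?X = "{x. abs_trace m (?S v * diff_deriv F (A0 u) x) = j - abs_trace m (v * C0 u)}"
    \<comment> \<open>The level set for \<open>G\<close> is the preimage under the bijection
      \<open>A\<close> of one for \<open>F\<close>.\<close>
    have "{x. abs_trace m (v * diff_deriv G u x) = j} = A -` ?X"
      by (auto simp: trace algebra_simps)
    moreover have "card (A -` ?X) = card ?X"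
      using \<open>bij A\<close> by (intro card_vimage_inj) (auto simp: bij_def)
    ultimately show ?thesis
      by (simp add: level_count_def)
  qed
  have ac: "autocorr TYPE('p) m G u v =
      zeta_pow (abs_trace m (v * C0 u) :: 'p mod_ring) * autocorr TYPE('p) m F (A0 u) (?S v)" for u v
  proof -
    let ?f = "\<lambda>x. zeta_pow (abs_trace m (?S v * diff_deriv F (A0 u) x) :: 'p mod_ring)"
    have "autocorr TYPE('p) m G u v =
        zeta_pow (abs_trace m (v * C0 u) :: 'p mod_ring) * (\<Sum>x\<in>UNIV. ?f (A x))"
      by (simp add: autocorr_def trace zeta_pow_add mult.commute sum_distrib_left)
    also have "(\<Sum>x\<in>UNIV. ?f (A x)) = sum ?f UNIV"
      by (rule sum.reindex_bij_betw) fact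
    finally show ?thesis
      by (simp add: autocorr_def)
  qed
  \<comment> \<open>Vanishing of \<open>C\<close> only says that \<open>C0 x + c\<close> is zero;
    evaluation at \<open>0\<close> gives \<open>c = 0\<close>, and then \<open>C0\<close>
    vanishes.\<close>
  have "C0 u = 0" if "C = (\<lambda>x. 0)" for u
  proof -
    have *: "C0 x + c = 0" for x
      using that assms(12) by metis
    have "C0 0 = 0"
      using C0 by (metis add_cancel_right_right add_0)
    then show ?thesis
      using *[of 0] *[of u] by simp
  qed
  then show ?thesis
    by (auto simp: level ac abs_trace_0[OF card_b])
qed

end
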